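(* Let $f(x)=\sum_{j=0}^nc_je^{\langle x,\alpha_j\rangle}+c_\beta e^{\langle x,\beta\rangle}$ be a circuit function with $A^+=\{\alpha_0,\ldots,\alpha_n\}\subset\mathbb{R}^n$, inner point $\beta$, and $c_\beta<0$. Then $f$ belongs to the boundary of the DSONC cone $D_{A^+,\beta}$, i.e. the dual circuit number inequality $-c_\beta\le\check\Theta_f$ is satisfied with equality, if and only if $$|c_\beta|\ =\ c_0e^{\langle\mathrm{eq}(f),\alpha_0-\beta\rangle}\ =\ \cdots\ =\ c_ne^{\langle\mathrm{eq}(f),\alpha_n-\beta\rangle}.$$
   Context: Circuit function here means: $A^+=\{\alpha_0,\dots,\alpha_n\}\subset\mathbb{R}^n$ is affinely independent, $\beta$ lies in the interior of the simplex $\mathrm{conv}(A^+)$, and $c_j>0$ for all $j$. The barycentric coordinates are the unique $\lambda\in(0,1)^{n+1}$ with $\sum_j\lambda_j\alpha_j=\beta$, $\sum_j\lambda_j=1$, and the dual circuit number is $\check\Theta_f=\prod_{j=0}^nc_j^{\lambda_j}$. DSONC cone of the circuit: $D_{A^+,\beta}$ is the set of all exponential sums $\sum_jd_je^{\langle x,\alpha_j\rangle}+d_\beta e^{\langle x,\beta\rangle}$ with $d_j\ge0$ for all $j$ and $-d_\beta\le\prod_{j=0}^nd_j^{\lambda_j}$, viewed as a subset of $\mathbb{R}^{n+2}$ via coefficient vectors. Point of equilibrium: $\mathrm{eq}(f)\in\mathbb{R}^n$ is the unique point satisfying $c_0e^{\langle\mathrm{eq}(f),\alpha_0-\beta\rangle}=\cdots=c_ne^{\langle\mathrm{eq}(f),\alpha_n-\beta\rangle}$.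 *)

theory Defs
  imports "HOL-Analysis.Analysis"
begin

text \<open>
  The exponents \<open>\<alpha>\<^sub>0, \<dots>, \<alpha>\<^sub>n\<close> in \<open>\<real>\<^sup>n\<close> are a family \<open>\<alpha> :: 'k \<Rightarrow> real^'n\<close>, where
  \<open>n = CARD('n)\<close> and the finite index type \<open>'k\<close> plays the role of \<open>{0, \<dots>, n}\<close>. The space
  \<open>\<real>\<^sup>n\<^sup>+\<^sup>2\<close> of coefficient vectors \<open>(c, c\<^sub>\<beta>)\<close> is \<open>(real^'k) \<times> real\<close>.
\<close>

definition exp_sum ::
    "('k::finite \<Rightarrow> real^'n) \<Rightarrow> real^'n \<Rightarrow> (real^'k) \<times> real \<Rightarrow> real^'n \<Rightarrow> real" where
  "exp_sum \<alpha> \<beta> v x = (\<Sum>j\<in>UNIV. fst v $ j * exp (x \<bullet> \<alpha> j)) + snd v * exp (x \<bullet> \<beta>)"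

definition circuit :: "('k::finite \<Rightarrow> real^'n) \<Rightarrow> real^'n \<Rightarrow> bool" where
  "circuit \<alpha> \<beta> \<longleftrightarrow>
     CARD('k) = CARD('n) + 1 \<and> inj \<alpha> \<and> \<not> affine_dependent (range \<alpha>) \<and>
     \<beta> \<in> interior (convex hull (range \<alpha>))"

definition barycentric :: "('k::finite \<Rightarrow> real^'n) \<Rightarrow> real^'n \<Rightarrow> real^'k" where
  "barycentric \<alpha> \<beta> = (THE l. (\<forall>j. 0 < l $ j \<and> l $ j < 1) \<and>
      (\<Sum>j\<in>UNIV. (l $ j) *\<^sub>R \<alpha> j) = \<beta> \<and> (\<Sum>j\<in>UNIV. l $ j) = 1)"

text \<open>Since \<open>0 powr a = 0\<close>, the product vanishes as soon as one of the coefficients is zero.\<close>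

definition dual_circuit_number ::
    "('k::finite \<Rightarrow> real^'n) \<Rightarrow> real^'n \<Rightarrow> real^'k \<Rightarrow> real" where
  "dual_circuit_number \<alpha> \<beta> c = (\<Prod>j\<in>UNIV. (c $ j) powr (barycentric \<alpha> \<beta> $ j))"

definition dsonc_cone :: "('k::finite \<Rightarrow> real^'n) \<Rightarrow> real^'n \<Rightarrow> (real^'n \<Rightarrow> real) set" where
  "dsonc_cone \<alpha> \<beta> = {exp_sum \<alpha> \<beta> (d, d\<beta>) | d d\<beta>.
     (\<forall>j. 0 \<le> d $ j) \<and> - d\<beta> \<le> dual_circuit_number \<alpha> \<beta> d}"

text \<open>
  A set of exponential sums viewed inside the space of coefficient vectors; this is where
  topological notions such as the boundary are taken.
\<close>

definition coeff_vectors ::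
    "('k::finite \<Rightarrow> real^'n) \<Rightarrow> real^'n \<Rightarrow> (real^'n \<Rightarrow> real) set \<Rightarrow> ((real^'k) \<times> real) set" where
  "coeff_vectors \<alpha> \<beta> F = {v. exp_sum \<alpha> \<beta> v \<in> F}"

definition equilibrium :: "('k::finite \<Rightarrow> real^'n) \<Rightarrow> real^'n \<Rightarrow> real^'k \<Rightarrow> real^'n" where
  "equilibrium \<alpha> \<beta> c =
     (THE x. \<forall>i j. c $ i * exp (x \<bullet> (\<alpha> i - \<beta>)) = c $ j * exp (x \<bullet> (\<alpha> j - \<beta>)))"

end

theory Submission
  imports Defs
begin

text \<open>
  At the equilibrium point all the values \<open>c\<^sub>j exp \<langle>eq(f), \<alpha>\<^sub>j - \<beta>\<rangle>\<close> equal some \<open>K\<close>. Their weighted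
  geometric mean with weights \<open>\<lambda>\<^sub>j\<close> is then \<open>K\<close> as well, but since \<open>\<Sum>\<^sub>j \<lambda>\<^sub>j (\<alpha>\<^sub>j - \<beta>) = 0\<close> the
  exponential factors cancel in it and leave the dual circuit number; hence \<open>K\<close> is the dual
  circuit number. On the topological side, exponentials with distinct exponents are linearly
  independent, so the cone is \<open>{(d, t). d \<ge> 0, - t \<le> \<Prod>\<^sub>j d\<^sub>j\<^bsup>\<lambda>\<^sub>j\<^esup>}\<close>, and near a point with
  positive \<open>d\<close> its boundary is cut out by equality in this continuous condition.
\<close>

section \<open>Linear independence of exponentials\<close>

lemma exp_inner_independent:
  fixes u :: "'a::real_inner \<Rightarrow> real"
  assumes "finite S" and "\<And>x. (\<Sum>a\<in>S. u a * exp (x \<bullet> a)) = 0"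
  shows "\<forall>a\<in>S. u a = 0"
  using assms
proof (induction S rule: finite_psubset_induct)
  case (psubset S)
  show ?case
  proof (cases "S = {}")
    case False
    txt \<open>
      Along the ray through an exponent \<open>m\<close> of maximal norm, the term of \<open>m\<close> dominates.
    \<close>
    with psubset.hyps have "Max (norm ` S) \<in> norm ` S"
      by (intro Max_in) auto
    then obtain m where "m \<in> S" "Max (norm ` S) = norm m"
      by auto
    with psubset.hyps have m: "m \<in> S" "\<And>a. a \<in> S \<Longrightarrow> norm a \<le> norm m"
      by (auto simp flip: \<open>Max (norm ` S) = norm m\<close>)
    \<comment> \<open>Expanding \<open>0 < (a - m) \<bullet> (a - m)\<close> bounds twice
      \<open>m \<bullet> a\<close> strictly by the sum of the squared norms, which is at most twice
      \<open>m \<bullet> m\<close>.\<close>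
    have lt: "m \<bullet> a - m \<bullet> m < 0" if "a \<in> S" "a \<noteq> m" for a
    proof -
      have "(norm a)\<^sup>2 \<le> (norm m)\<^sup>2"
        using m(2)[OF that(1)] by (intro power_mono) auto
      moreover have "0 < (a - m) \<bullet> (a - m)"
        using that by simp
      ultimately show ?thesis
        by (simp add: inner_diff inner_commute power2_norm_eq_inner)
    qed
    \<comment> \<open>After division by the dominant factor
      \<open>exp (t * (m \<bullet> m))\<close>, only the term of \<open>m\<close> survives in the
      limit.\<close>
    have "((\<lambda>t::real. \<Sum>a\<in>S. u a * exp (t * (m \<bullet> a - m \<bullet> m)))
             \<longlongrightarrow> (\<Sum>a\<in>S. if a = m then u m else 0)) at_top"
    proof (intro tendsto_sum)
      fix a assume a: "a \<in> S"
      show "((\<lambda>t::real. u a * exp (t * (m \<bullet> a - m \<bullet> m))) \<longlongrightarrow> (if a = m then u m else 0)) at_top"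
      proof (cases "a = m")
        case False
        have "filterlim (\<lambda>t::real. t * (m \<bullet> a - m \<bullet> m)) at_bot at_top"
          using filterlim_tendsto_neg_mult_at_bot[OF tendsto_const lt[OF a False] filterlim_ident]
          by (simp only: mult.commute)
        then have "((\<lambda>t::real. exp (t * (m \<bullet> a - m \<bullet> m))) \<longlongrightarrow> 0) at_top"
          by (rule filterlim_compose[OF exp_at_bot])
        then show ?thesis
          using False tendsto_mult_right_zero by auto
      qed simp
    qed
    moreover have "(\<Sum>a\<in>S. u a * exp (t * (m \<bullet> a - m \<bullet> m))) = 0" for t :: real
    proof -
      have "(\<Sum>a\<in>S. u a * exp (t * (m \<bullet> a - m \<bullet> m)))
          = exp (- (t * (m \<bullet> m))) * (\<Sum>a\<in>S. u a * exp ((t *\<^sub>R m) \<bullet> a))"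
        by (simp add: sum_distrib_left right_diff_distrib exp_diff exp_minus field_simps)
      then show ?thesis
        by (simp only: psubset.prems mult_zero_right)
    qed
    ultimately have "(\<Sum>a\<in>S. if a = m then u m else 0) = 0"
      by (simp add: tendsto_const_iff)
    then have um: "u m = 0"
      using m(1) psubset.hyps by simp
    have "(\<Sum>a\<in>S - {m}. u a * exp (x \<bullet> a)) = 0" for x
      using psubset.prems[of x] um m(1) psubset.hyps by (simp add: sum.remove)
    then have "\<forall>a\<in>S - {m}. u a = 0"
      using m(1) by (intro psubset.IH) auto
    with um show ?thesis by auto
  qed simp
qed

text \<open>Pairwise distinct exponents keep coefficients from merging, so linear independence
  applies to the coefficient differences.\<close>

lemma exp_sum_inj:
  fixes \<alpha> :: "'k::finite \<Rightarrow> real^'n"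
  assumes "inj \<alpha>" and "\<beta> \<notin> range \<alpha>" and "exp_sum \<alpha> \<beta> v = exp_sum \<alpha> \<beta> w"
  shows "v = w"
proof -
  \<comment> \<open>\<open>u\<close> indexes the differences by exponents instead of by
    \<open>'k\<close>; its two cases do not collide since \<open>\<beta>\<close> is no
    vertex.\<close>
  define u where
    "u = (\<lambda>a. if a = \<beta> then snd v - snd w else (fst v - fst w) $ inv \<alpha> a)"
  have u\<alpha>: "u (\<alpha> j) = fst v $ j - fst w $ j" for j
    using assms by (auto simp: u_def)
  have "(\<Sum>a\<in>insert \<beta> (range \<alpha>). u a * exp (x \<bullet> a)) = exp_sum \<alpha> \<beta> v x - exp_sum \<alpha> \<beta> w x" for x
  proof -
    have "(\<Sum>a\<in>range \<alpha>. u a * exp (x \<bullet> a)) = (\<Sum>j\<in>UNIV. (fst v $ j - fst w $ j) * exp (x \<bullet> \<alpha> j))"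
      using assms(1) by (simp add: sum.reindex u\<alpha>)
    then show ?thesis
      using assms(2) by (simp add: exp_sum_def u_def left_diff_distrib sum_subtractf)
  qed
  then have "\<forall>a\<in>insert \<beta> (range \<alpha>). u a = 0"
    using assms(3) by (intro exp_inner_independent) auto
  then have "u \<beta> = 0" "\<And>j. u (\<alpha> j) = 0"
    by auto
  then show ?thesis
    unfolding u\<alpha> by (simp add: u_def prod_eq_iff vec_eq_iff)
qed

section \<open>Barycentric coordinates of the inner point\<close>

text \<open>With n + 1 vertices the simplex is full-dimensional, so its interior consists of the
  combinations with weights in (0,1). Two different weight vectors for \<open>\<beta>\<close> would
  differ by an affine dependence.\<close>

lemma circuit_barycentric_ex1:
  fixes \<alpha> :: "'k::finite \<Rightarrow> real^'n"
  assumes "circuit \<alpha> \<beta>"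
  shows "\<exists>!l::real^'k. (\<forall>j. 0 < l $ j \<and> l $ j < 1) \<and>
      (\<Sum>j\<in>UNIV. (l $ j) *\<^sub>R \<alpha> j) = \<beta> \<and> (\<Sum>j\<in>UNIV. l $ j) = 1"
proof -
  have inj: "inj \<alpha>" and ind: "\<not> affine_dependent (range \<alpha>)"
    and int: "\<beta> \<in> interior (convex hull (range \<alpha>))" and card: "CARD('k) = CARD('n) + 1"
    using assms by (auto simp: circuit_def)
  have "card (range \<alpha>) = CARD('n) + 1"
    using inj card by (simp add: card_image)
  with int obtain u where u: "\<forall>x\<in>range \<alpha>. 0 < u x \<and> u x < 1" "sum u (range \<alpha>) = 1"
      "(\<Sum>x\<in>range \<alpha>. u x *\<^sub>R x) = \<beta>"
    by (auto simp: interior_convex_hull_explicit[OF ind])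
  show ?thesis
  proof (rule ex1I)
    show "(\<forall>j. 0 < (\<chi> j. u (\<alpha> j)) $ j \<and> (\<chi> j. u (\<alpha> j)) $ j < 1) \<and>
      (\<Sum>j\<in>UNIV. ((\<chi> j. u (\<alpha> j)) $ j) *\<^sub>R \<alpha> j) = \<beta> \<and> (\<Sum>j\<in>UNIV. (\<chi> j. u (\<alpha> j)) $ j) = 1"
      using u inj by (simp add: sum.reindex)
  next
    fix l :: "real^'k"
    assume l: "(\<forall>j. 0 < l $ j \<and> l $ j < 1) \<and>
      (\<Sum>j\<in>UNIV. (l $ j) *\<^sub>R \<alpha> j) = \<beta> \<and> (\<Sum>j\<in>UNIV. l $ j) = 1"
    define w where "w = (\<lambda>x. l $ inv \<alpha> x - u x)"
    have "sum w (range \<alpha>) = 0" "(\<Sum>x\<in>range \<alpha>. w x *\<^sub>R x) = 0"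
      using l u inj by (simp_all add: w_def sum.reindex sum_subtractf scaleR_diff_left)
    then have "\<forall>x\<in>range \<alpha>. w x = 0"
      using ind by (auto simp: affine_dependent_explicit_finite)
    then show "l = (\<chi> j. u (\<alpha> j))"
      using inj by (simp add: w_def vec_eq_iff)
  qed
qed

lemma circuit_barycentric:
  fixes \<alpha> :: "'k::finite \<Rightarrow> real^'n"
  assumes "circuit \<alpha> \<beta>"
  shows "0 < barycentric \<alpha> \<beta> $ j" "barycentric \<alpha> \<beta> $ j < 1"
    "(\<Sum>j\<in>UNIV. (barycentric \<alpha> \<beta> $ j) *\<^sub>R \<alpha> j) = \<beta>"
    "(\<Sum>j\<in>UNIV. barycentric \<alpha> \<beta> $ j) = 1"
  using theI'[OF circuit_barycentric_ex1[OF assms]] unfolding barycentric_def by auto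

text \<open>Vertices of a simplex are extreme points, and these never lie in the interior.\<close>

lemma circuit_inner_notin_vertices:
  fixes \<alpha> :: "'k::finite \<Rightarrow> real^'n"
  assumes "circuit \<alpha> \<beta>"
  shows "\<beta> \<notin> range \<alpha>"
proof
  assume "\<beta> \<in> range \<alpha>"
  then have "\<beta> extreme_point_of (convex hull (range \<alpha>))"
    using assms extreme_point_of_convex_hull_affine_independent by (auto simp: circuit_def)
  then show False
    using assms extreme_point_not_in_interior by (auto simp: circuit_def)
qed

section \<open>The cone and its boundary in coefficient space\<close>

text \<open>Since \<open>exp_sum \<alpha> \<beta>\<close> is injective, passing to functions and
  pulling back adds no coefficient vectors.\<close>

lemma coeff_vectors_dsonc_cone:
  fixes \<alpha> :: "'k::finite \<Rightarrow> real^'n"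
  assumes "circuit \<alpha> \<beta>"
  shows "coeff_vectors \<alpha> \<beta> (dsonc_cone \<alpha> \<beta>)
    = {(d, t). (\<forall>j. 0 \<le> d $ j) \<and> - t \<le> dual_circuit_number \<alpha> \<beta> d}"
proof -
  have "v = w" if "exp_sum \<alpha> \<beta> v = exp_sum \<alpha> \<beta> w" for v w
    using exp_sum_inj[OF _ circuit_inner_notin_vertices[OF assms] that] assms
    by (simp add: circuit_def)
  then show ?thesis
    unfolding coeff_vectors_def dsonc_cone_def by blast
qed

text \<open>As \<open>c\<close> is positive, the sign constraints are slack nearby, so the sign of
  the last coordinate plus the dual circuit number decides: positive means interior, negative
  exterior.\<close>

lemma frontier_dsonc_cone_iff:
  fixes \<alpha> :: "'k::finite \<Rightarrow> real^'n"
  assumes "circuit \<alpha> \<beta>" and c: "\<forall>j. 0 < c $ j"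
  shows "(c, t) \<in> frontier (coeff_vectors \<alpha> \<beta> (dsonc_cone \<alpha> \<beta>))
    \<longleftrightarrow> - t = dual_circuit_number \<alpha> \<beta> c"
proof -
  let ?\<Theta> = "dual_circuit_number \<alpha> \<beta>"
  define S where "S = coeff_vectors \<alpha> \<beta> (dsonc_cone \<alpha> \<beta>)"
  have S: "p \<in> S \<longleftrightarrow> (\<forall>j. 0 \<le> fst p $ j) \<and> 0 \<le> snd p + ?\<Theta> (fst p)" for p
    unfolding S_def coeff_vectors_dsonc_cone[OF assms(1)] by (cases p) auto
  have fst: "((\<lambda>p. fst p $ j) \<longlongrightarrow> c $ j) (nhds (c, t))" for j
    using tendsto_vec_nth[OF tendsto_fst[OF filterlim_ident[of "nhds (c, t)"]], of j] by simp
  have snd: "(snd \<longlongrightarrow> t) (nhds (c, t))"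
    using tendsto_snd[OF filterlim_ident[of "nhds (c, t)"]] by simp
  \<comment> \<open>The limit rule for \<open>powr\<close> asks for a nonzero base.\<close>
  have "c $ j \<noteq> 0" for j
    using c by (metis less_irrefl)
  then have lim: "((\<lambda>p. snd p + ?\<Theta> (fst p)) \<longlongrightarrow> t + ?\<Theta> c) (nhds (c, t))"
    unfolding dual_circuit_number_def
    by (intro tendsto_add snd tendsto_prod tendsto_powr fst tendsto_const)
  have pos: "\<forall>\<^sub>F p in nhds (c, t). \<forall>j. 0 < fst p $ j"
    by (intro eventually_all_finite order_tendstoD(1)[OF fst]) (use c in auto)
  consider "0 < t + ?\<Theta> c" | "t + ?\<Theta> c < 0" | "t + ?\<Theta> c = 0"
    by linarith
  then show ?thesis
  proof cases
    case 1
    have "\<forall>\<^sub>F p in nhds (c, t). p \<in> S"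
      using order_tendstoD(1)[OF lim 1] pos
      by eventually_elim (auto simp: S less_imp_le)
    then have "(c, t) \<in> interior S"
      by (auto simp: eventually_nhds interior_def)
    with 1 show ?thesis
      by (simp add: frontier_def S_def[symmetric])
  next
    case 2
    have "\<forall>\<^sub>F p in nhds (c, t). p \<in> - S"
      using order_tendstoD(2)[OF lim 2]
      by eventually_elim (auto simp: S)
    then have "(c, t) \<in> interior (- S)"
      by (auto simp: eventually_nhds interior_def)
    with 2 show ?thesis
      by (simp add: frontier_def S_def[symmetric] closure_interior)
  next
    case 3
    have "(c, t) \<in> S"
      using c 3 by (simp add: S less_imp_le)
    moreover have "(c, t) \<notin> interior S"
    proof
      assume "(c, t) \<in> interior S"
      then obtain e where e: "e > 0" "ball (c, t) e \<subseteq> S"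
        by (auto simp: mem_interior)
      \<comment> \<open>Lowering the last coordinate by \<open>e / 2\<close> stays in the ball but
        violates the inequality, which is tight at \<open>(c, t)\<close>.\<close>
      then have "(c, t - e / 2) \<in> S"
        by (intro subsetD[OF e(2)]) (simp add: dist_Pair_Pair dist_real_def)
      with 3 e(1) show False
        by (simp add: S)
    qed
    ultimately have "(c, t) \<in> frontier S"
      using closure_subset by (auto simp: frontier_def)
    with 3 show ?thesis
      by (simp add: S_def[symmetric])
  qed
qed

section \<open>Existence and uniqueness of the equilibrium\<close>

text \<open>Differences from a fixed vertex are linearly independent, so a linear functional can be
  prescribed on them; \<open>k\<close> absorbs the offset at that vertex.\<close>

lemma affine_independent_inner_interpolation:
  fixes \<alpha> :: "'k \<Rightarrow> 'a::euclidean_space" and h :: "'k \<Rightarrow> real"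
  assumes "inj \<alpha>" and "\<not> affine_dependent (range \<alpha>)"
  shows "\<exists>x k. \<forall>j. x \<bullet> \<alpha> j = h j + k"
proof -
  fix i :: 'k
  let ?B = "(\<lambda>x. x - \<alpha> i) ` (range \<alpha> - {\<alpha> i})"
  have "independent ?B"
    using assms(2) affine_dependent_iff_dependent2[of "\<alpha> i" "range \<alpha>"] by simp
  then obtain g :: "'a \<Rightarrow> real" where g: "linear g"
      "\<forall>y\<in>?B. g y = h (inv \<alpha> (y + \<alpha> i)) - h i"
    using linear_independent_extend[of ?B "\<lambda>y. h (inv \<alpha> (y + \<alpha> i)) - h i"] by blast
  have gj: "g (\<alpha> j - \<alpha> i) = h j - h i" for j
  proof (cases "j = i")
    case True
    then show ?thesis using linear_0[OF g(1)] by simp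
  next
    case False
    then have "\<alpha> j - \<alpha> i \<in> ?B"
      using assms(1) by (auto simp: inj_eq)
    then show ?thesis
      using bspec[OF g(2), of "\<alpha> j - \<alpha> i"] assms(1) by simp
  qed
  \<comment> \<open>\<open>adjoint g 1\<close> is the vector representing the functional
    \<open>g\<close>.\<close>
  have "g y = adjoint g 1 \<bullet> y" for y
    using adjoint_works[OF g(1), of y 1] by (simp add: inner_commute)
  then have "adjoint g 1 \<bullet> \<alpha> j = h j + (adjoint g 1 \<bullet> \<alpha> i - h i)" for j
    using gj[of j] by (simp add: inner_diff_right)
  then show ?thesis by blast
qed

text \<open>Otherwise the hull would lie in a hyperplane, which has empty interior.\<close>

lemma inner_const_imp_zero:
  fixes z :: "'a::euclidean_space"
  assumes "\<And>a. a \<in> A \<Longrightarrow> z \<bullet> a = k" and "interior (convex hull A) \<noteq> {}"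
  shows "z = 0"
proof (rule ccontr)
  assume z: "z \<noteq> 0"
  have "convex hull A \<subseteq> {x. z \<bullet> x = k}"
    using assms(1) by (intro hull_minimal) (auto simp: convex_hyperplane)
  then have "interior (convex hull A) \<subseteq> interior {x. z \<bullet> x = k}"
    by (rule interior_mono)
  with assms(2) z show False
    by (simp add: interior_hyperplane)
qed

text \<open>Logarithms make the system linear: \<open>ln (c $ j) + x \<bullet> \<alpha> j\<close>
  must not depend on \<open>j\<close>. Interpolating \<open>- ln (c $ j)\<close> solves it, and the
  difference of two solutions has constant inner product with the vertices, hence vanishes.\<close>

lemma circuit_equilibrium_ex1:
  fixes \<alpha> :: "'k::finite \<Rightarrow> real^'n"
  assumes "circuit \<alpha> \<beta>" and c: "\<forall>j. 0 < c $ j"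
  shows "\<exists>!x. \<forall>i j. c $ i * exp (x \<bullet> (\<alpha> i - \<beta>)) = c $ j * exp (x \<bullet> (\<alpha> j - \<beta>))"
proof -
  have inj: "inj \<alpha>" and ind: "\<not> affine_dependent (range \<alpha>)"
    and int: "\<beta> \<in> interior (convex hull (range \<alpha>))"
    using assms by (auto simp: circuit_def)
  have eq: "c $ j * exp (x \<bullet> (\<alpha> j - \<beta>)) = exp (ln (c $ j) + x \<bullet> \<alpha> j - x \<bullet> \<beta>)" for x j
    using c by (simp add: exp_add exp_diff inner_diff_right)
  obtain x k where x: "\<And>j. x \<bullet> \<alpha> j = - ln (c $ j) + k"
    using affine_independent_inner_interpolation[OF inj ind, of "\<lambda>j. - ln (c $ j)"] by blast
  show ?thesis
    unfolding eq
  proof (rule ex1I)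
    show "\<forall>i j. exp (ln (c $ i) + x \<bullet> \<alpha> i - x \<bullet> \<beta>) = exp (ln (c $ j) + x \<bullet> \<alpha> j - x \<bullet> \<beta>)"
      by (simp add: x)
  next
    fix y
    assume y: "\<forall>i j. exp (ln (c $ i) + y \<bullet> \<alpha> i - y \<bullet> \<beta>) = exp (ln (c $ j) + y \<bullet> \<alpha> j - y \<bullet> \<beta>)"
    fix i :: 'k
    have "(y - x) \<bullet> \<alpha> j = (y - x) \<bullet> \<alpha> i" for j
      using y[rule_format, of i j] by (simp add: inner_diff_left x)
    then have "y - x = 0"
      using int by (intro inner_const_imp_zero[of "range \<alpha>" _ "(y - x) \<bullet> \<alpha> i"]) auto
    then show "y = x" by simp
  qed
qed

section \<open>The equilibrium value as dual circuit number\<close>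

lemma dual_circuit_number_eq_equilibrium_value:
  fixes \<alpha> :: "'k::finite \<Rightarrow> real^'n"
  assumes "circuit \<alpha> \<beta>" and c: "\<forall>j. 0 < c $ j"
    and K: "\<And>j. c $ j * exp (x \<bullet> (\<alpha> j - \<beta>)) = K"
  shows "dual_circuit_number \<alpha> \<beta> c = K"
proof -
  let ?l = "barycentric \<alpha> \<beta>"
  note bary = circuit_barycentric[OF assms(1)]
  have "0 < K"
    using K c by (metis exp_gt_zero mult_pos_pos)
  have nz: "c $ j \<noteq> 0" for j
    using c by (metis less_irrefl)
  have "ln (c $ j) = ln K - x \<bullet> (\<alpha> j - \<beta>)" for j
    using nz by (simp add: ln_mult flip: K[of j])
  then have "(\<Sum>j\<in>UNIV. ?l $ j * ln (c $ j))
      = (\<Sum>j\<in>UNIV. ?l $ j * (ln K + x \<bullet> \<beta>)) - x \<bullet> (\<Sum>j\<in>UNIV. ?l $ j *\<^sub>R \<alpha> j)"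
    by (simp add: inner_sum_right inner_diff_right right_diff_distrib distrib_left
        sum.distrib sum_subtractf)
  \<comment> \<open>The weights sum to 1 and average the vertices to \<open>\<beta>\<close>, so the
    two \<open>x \<bullet> \<beta>\<close> terms cancel.\<close>
  also have "\<dots> = ln K"
    by (simp only: bary sum_distrib_right[symmetric]) simp
  finally have "exp (\<Sum>j\<in>UNIV. ?l $ j * ln (c $ j)) = K"
    using \<open>0 < K\<close> by simp
  \<comment> \<open>Here \<open>exp_sum\<close> is the rule turning the exponential of a sum into a
    product, not the function defined for circuits.\<close>
  then show ?thesis
    by (simp add: dual_circuit_number_def powr_def exp_sum nz)
qed

theorem corollary6p2:
  fixes \<alpha> :: "'k::finite \<Rightarrow> real^'n" and \<beta> :: "real^'n"
    and c :: "real^'k" and c\<beta> :: real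
  assumes "circuit \<alpha> \<beta>"
    and "\<forall>j. 0 < c $ j"
    and "c\<beta> < 0"
  shows "((c, c\<beta>) \<in> frontier (coeff_vectors \<alpha> \<beta> (dsonc_cone \<alpha> \<beta>))
            \<longleftrightarrow> - c\<beta> = dual_circuit_number \<alpha> \<beta> c) \<and>
         ((c, c\<beta>) \<in> frontier (coeff_vectors \<alpha> \<beta> (dsonc_cone \<alpha> \<beta>))
            \<longleftrightarrow> (\<forall>j. \<bar>c\<beta>\<bar> = c $ j * exp (equilibrium \<alpha> \<beta> c \<bullet> (\<alpha> j - \<beta>))))"
proof -
  let ?K = "\<lambda>j. c $ j * exp (equilibrium \<alpha> \<beta> c \<bullet> (\<alpha> j - \<beta>))"
  have "\<forall>i j. ?K i = ?K j"
    unfolding equilibrium_def by (rule theI'[OF circuit_equilibrium_ex1[OF assms(1,2)]])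
  then have "dual_circuit_number \<alpha> \<beta> c = ?K j" for j
    by (intro dual_circuit_number_eq_equilibrium_value[OF assms(1,2)]) blast
  then show ?thesis
    \<comment> \<open>As \<open>c\<beta>\<close> is negative, its absolute value is
      \<open>- c\<beta>\<close>, so both right-hand sides state the same equality.\<close>
    using frontier_dsonc_cone_iff[OF assms(1,2)] assms(3) by (metis abs_of_neg)
qed

end
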